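(* Let $\tau,\nu$ be consecutive patterns. For any shuffle pattern $\tau\text{-}\ell\text{-}\nu$ (resp. $\tau\text{-}1\text{-}\nu$), we have $\tau\text{-}\ell\text{-}\nu\equiv\nu\text{-}\ell\text{-}\tau$ (resp. $\tau\text{-}1\text{-}\nu\equiv\nu\text{-}1\text{-}\tau$).
   Context: A composition $\sigma=\sigma_1\ldots\sigma_m$ of $n$ with $m$ parts in a finite set $A$ of positive integers is a sequence of $m$ elements of $A$ with sum $n$; the set of these is $C_{n;m}^A$. A partially ordered pattern (POP) is a word $\rho_1\ldots\rho_r$ of letters from a partially ordered alphabet (repeated letters allowed), possibly with dashes between some neighbouring letters. An occurrence of $\rho$ in $\sigma$ is a choice of positions $i_1<\cdots<i_r$ such that: $i_{p+1}=i_p+1$ whenever there is no dash between $\rho_p$ and $\rho_{p+1}$; $\sigma_{i_p}=\sigma_{i_q}$ whenever $\rho_p=\rho_q$; and $\sigma_{i_p}<\sigma_{i_q}$ whenever $\rho_p<\rho_q$. Nothing is required for incomparable letters. $\sigma$ avoids $\rho$ if it has no occurrence of $\rho$. Two POPs are equivalent, written $\equiv$, if for every finite set $A$ of positive integers and all $n,m$ the number of compositions in $C_{n;m}^A$ that avoid the first equals the number that avoid the second. A consecutive pattern is a dash-free word over a totally ordered alphabet $[t]=\{1,\dots,t\}$ that contains each letter of $[t]$ at least once. The shuffle pattern $\tau\text{-}\ell\text{-}\nu$ is the POP consisting of the word $\tau$, a dash, a single letter $\ell$, a dash, and the word $\nu$, where every letter of $\tau$ is incomparable to every letter of $\nu$,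 the order inside $\tau$ and inside $\nu$ is kept, and $\ell$ is greater than every letter of $\tau$ and of $\nu$. The shuffle pattern $\tau\text{-}1\text{-}\nu$ is defined in the same way, except that the middle letter is smaller than every letter of $\tau$ and of $\nu$. *)

theory Defs
  imports Main
begin

definition compositions :: "nat set \<Rightarrow> nat \<Rightarrow> nat \<Rightarrow> nat list set" where
  "compositions A n m = {\<sigma>. length \<sigma> = m \<and> set \<sigma> \<subseteq> A \<and> sum_list \<sigma> = n}"

text \<open>
  A partially ordered pattern \<open>\<rho>\<^sub>1\<dots>\<rho>\<^sub>r\<close>: its word, the set of those \<open>p\<close> for which there is a dash
  between the \<open>p\<close>-th and the \<open>(p + 1)\<close>-th letter (counting letters from 1), and the strict order
  of its alphabet, as described by \<open>is_pop\<close>.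
\<close>

datatype 'a pop = POP (letters: "'a list") (dashes: "nat set") (less: "'a \<Rightarrow> 'a \<Rightarrow> bool")

definition is_pop :: "'a pop \<Rightarrow> bool" where
  "is_pop P \<longleftrightarrow> irreflp (less P) \<and> transp (less P)"

text \<open>
  Here letters and positions are indexed from 0, so the dash after the letter with index \<open>p\<close>
  is recorded as \<open>Suc p\<close>.
\<close>

definition occurrence :: "'a pop \<Rightarrow> nat list \<Rightarrow> nat list \<Rightarrow> bool" where
  "occurrence P \<sigma> is \<longleftrightarrow>
     (let \<rho> = letters P; r = length \<rho> in
      length is = r \<and> sorted_wrt (<) is \<and> (\<forall>i \<in> set is. i < length \<sigma>) \<and>
      (\<forall>p. Suc p < r \<and> Suc p \<notin> dashes P \<longrightarrow> is ! Suc p = Suc (is ! p)) \<and>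
      (\<forall>p < r. \<forall>q < r. \<rho> ! p = \<rho> ! q \<longrightarrow> \<sigma> ! (is ! p) = \<sigma> ! (is ! q)) \<and>
      (\<forall>p < r. \<forall>q < r. less P (\<rho> ! p) (\<rho> ! q) \<longrightarrow> \<sigma> ! (is ! p) < \<sigma> ! (is ! q)))"

definition avoids :: "nat list \<Rightarrow> 'a pop \<Rightarrow> bool" where
  "avoids \<sigma> P \<longleftrightarrow> \<not> (\<exists>is. occurrence P \<sigma> is)"

definition pop_equiv :: "'a pop \<Rightarrow> 'b pop \<Rightarrow> bool" where
  "pop_equiv P Q \<longleftrightarrow>
     (\<forall>A n m. finite A \<and> (\<forall>a \<in> A. 0 < a) \<longrightarrow>
        card {\<sigma> \<in> compositions A n m. avoids \<sigma> P} = card {\<sigma> \<in> compositions A n m. avoids \<sigma> Q})"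

definition consecutive_pattern :: "nat list \<Rightarrow> bool" where
  "consecutive_pattern \<tau> \<longleftrightarrow> (\<exists>t. set \<tau> = {1..t})"

text \<open>
  The alphabet of a shuffle pattern is the disjoint union of the alphabets of its two outer words
  and the middle letter.
\<close>

datatype shuffle_letter = Lft nat | Mid | Rgt nat

fun less_max :: "shuffle_letter \<Rightarrow> shuffle_letter \<Rightarrow> bool" where
  "less_max (Lft a) (Lft b) \<longleftrightarrow> a < b"
| "less_max (Rgt a) (Rgt b) \<longleftrightarrow> a < b"
| "less_max (Lft a) Mid \<longleftrightarrow> True"
| "less_max (Rgt a) Mid \<longleftrightarrow> True"
| "less_max _ _ \<longleftrightarrow> False"

fun less_min :: "shuffle_letter \<Rightarrow> shuffle_letter \<Rightarrow> bool" where
  "less_min (Lft a) (Lft b) \<longleftrightarrow> a < b"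
| "less_min (Rgt a) (Rgt b) \<longleftrightarrow> a < b"
| "less_min Mid (Lft a) \<longleftrightarrow> True"
| "less_min Mid (Rgt a) \<longleftrightarrow> True"
| "less_min _ _ \<longleftrightarrow> False"

definition shuffle ::
    "(shuffle_letter \<Rightarrow> shuffle_letter \<Rightarrow> bool) \<Rightarrow> nat list \<Rightarrow> nat list \<Rightarrow> shuffle_letter pop" where
  "shuffle lt \<tau> \<nu> =
     POP (map Lft \<tau> @ [Mid] @ map Rgt \<nu>) {length \<tau>, Suc (length \<tau>)} lt"

text \<open>The patterns \<open>\<tau>-\<ell>-\<nu>\<close> and \<open>\<tau>-1-\<nu>\<close>.\<close>

definition shuffle_max :: "nat list \<Rightarrow> nat list \<Rightarrow> shuffle_letter pop" where
  "shuffle_max = shuffle less_max"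

definition shuffle_min :: "nat list \<Rightarrow> nat list \<Rightarrow> shuffle_letter pop" where
  "shuffle_min = shuffle less_min"

lemma is_pop_shuffle_max: "is_pop (shuffle_max \<tau> \<nu>)"
proof -
  have "\<not> less_max x x" for x by (cases x) auto
  moreover have "less_max x z" if "less_max x y" "less_max y z" for x y z
    using that by (cases x; cases y; cases z) auto
  ultimately show ?thesis
    by (auto simp: is_pop_def shuffle_max_def shuffle_def intro!: irreflpI transpI)
qed

lemma is_pop_shuffle_min: "is_pop (shuffle_min \<tau> \<nu>)"
proof -
  have "\<not> less_min x x" for x by (cases x) auto
  moreover have "less_min x z" if "less_min x y" "less_min y z" for x y z
    using that by (cases x; cases y; cases z) auto
  ultimately show ?thesis
    by (auto simp: is_pop_def shuffle_min_def shuffle_def intro!: irreflpI transpI)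
qed

end

theory Submission
  imports Defs "HOL-Library.Sublist" "HOL-Computational_Algebra.Formal_Power_Series"
    "HOL-Computational_Algebra.Polynomial"
begin

text \<open>
  Only two features of a shuffle pattern matter: which factors of a word match \<open>\<tau>\<close> and which match
  \<open>\<nu>\<close>, and a linear order in which all letters of both factors lie below the middle letter: \<open><\<close> for
  \<open>\<tau>-\<ell>-\<nu>\<close>, \<open>>\<close> for \<open>\<tau>-1-\<nu>\<close>. So the argument runs over an arbitrary strict linear order and two
  arbitrary predicates \<open>T\<close>, \<open>N\<close> on factors, and both halves of the theorem are instances of it.

  Let \<open>k\<close> be the maximum of the alphabet \<open>A\<close> and \<open>B = A - {k}\<close>, and cut a word containing \<open>k\<close> at
  its first \<open>k\<close>, as \<open>u k v\<close> with \<open>u\<close> over \<open>B\<close> and \<open>v\<close> over \<open>A\<close>. A factor of letters below another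
  letter never contains \<open>k\<close>, so it lies within \<open>u\<close> or within \<open>v\<close>. If the left factor of an
  occurrence lies in \<open>u\<close> and the right one in \<open>v\<close>, this \<open>k\<close> can serve as the middle letter. Hence
  \<open>u k v\<close> avoids the shuffle iff \<open>u\<close> and \<open>v\<close> do and it is not the case that \<open>u\<close> contains a
  \<open>T\<close>-factor and \<open>v\<close> an \<open>N\<close>-factor without \<open>k\<close> (\<open>has_shuffle_around_maximum\<close>).

  Count words by sum and length with generating functions in \<open>x\<close> and \<open>y\<close>, and put \<open>z = x\<^sup>k y\<close>. Over
  \<open>B\<close> let \<open>a\<close>, \<open>b\<close>, \<open>c\<close> count the words without a \<open>T\<close>-factor, without an \<open>N\<close>-factor, and without
  the shuffle; over \<open>A\<close> let \<open>F\<close> count the words without the shuffle and \<open>D\<close> those without an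
  \<open>N\<close>-factor free of \<open>k\<close>. The decomposition reads
  \<open>D = b + z b D\<close> and \<open>F = c + z a F + z (c - a) D\<close>, and eliminating \<open>D\<close> gives
  \<open>F (1 - z a) (1 - z b) = c - z a b\<close> (\<open>gf_avoiding_shuffle\<close>). Exchanging \<open>T\<close> and \<open>N\<close> exchanges
  \<open>a\<close> and \<open>b\<close>; so if \<open>c\<close> is symmetric in \<open>T\<close> and \<open>N\<close>, then so is \<open>F\<close>, and induction on the
  alphabet finishes the proof (\<open>gf_avoiding_shuffle_sym\<close>).
\<close>

section \<open>Generating functions of sets of words\<close>

text \<open>
  This is the series in \<open>x\<close> (marking the sum) and \<open>y\<close> (marking the length), as a power series in
  \<open>y\<close> with polynomial coefficients. The coefficients are polynomials because a finite alphabet has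
  only finitely many words of each length; over an infinite set of words of one length the sum would
  collapse to 0, which is why the lemmas below ask for a finite alphabet.
\<close>

definition gf :: "nat list set \<Rightarrow> int poly fps" where
  "gf L = Abs_fps (\<lambda>m. \<Sum>w | w \<in> L \<and> length w = m. monom 1 (sum_list w))"

lemma finite_words_of_length:
  assumes "finite A" and "L \<subseteq> lists A"
  shows "finite {w. w \<in> L \<and> length w = m}"
  by (rule finite_subset[OF _ finite_lists_length_eq[OF assms(1), of m]]) (use assms(2) in auto)

lemma card_eq_coeff_gf:
  assumes "finite A" and "L \<subseteq> lists A"
  shows "int (card {w \<in> L. length w = m \<and> sum_list w = n}) = coeff (fps_nth (gf L) m) n"
proof -
  have "coeff (fps_nth (gf L) m) n
      = (\<Sum>w | w \<in> L \<and> length w = m. if sum_list w = n then 1 else 0)"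
    by (simp add: gf_def coeff_sum)
  also have "\<dots> = int (card ({w. w \<in> L \<and> length w = m} \<inter> {w. sum_list w = n}))"
    by (simp add: sum.If_cases finite_words_of_length[OF assms])
  also have "{w. w \<in> L \<and> length w = m} \<inter> {w. sum_list w = n}
      = {w \<in> L. length w = m \<and> sum_list w = n}"
    by auto
  finally show ?thesis by simp
qed

lemma gf_Un_disjoint:
  assumes "finite A" and "L \<subseteq> lists A" and "M \<subseteq> lists A" and "L \<inter> M = {}"
  shows "gf (L \<union> M) = gf L + gf M"
proof (rule fps_ext)
  fix m
  have "{w. w \<in> L \<union> M \<and> length w = m} = {w. w \<in> L \<and> length w = m} \<union> {w. w \<in> M \<and> length w = m}"
    by auto
  then show "fps_nth (gf (L \<union> M)) m = fps_nth (gf L + gf M) m"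
    using assms(4)
    by (simp add: gf_def)
      (rule sum.union_disjoint, use assms in \<open>auto intro: finite_words_of_length\<close>)
qed

definition join :: "nat \<Rightarrow> nat list set \<Rightarrow> nat list set \<Rightarrow> nat list set" where
  "join k L M = (\<lambda>(u, v). u @ k # v) ` (L \<times> M)"

text \<open>The weight \<open>x\<^sup>k y\<close> of the one-letter word \<open>k\<close>.\<close>

definition letter_gf :: "nat \<Rightarrow> int poly fps" where
  "letter_gf k = fps_X * fps_const (monom 1 k)"

lemma first_occurrence_unique:
  assumes "u @ k # v = u' @ k # v'" and "k \<notin> set u" and "k \<notin> set u'"
  shows "u = u' \<and> v = v'"
proof -
  have "takeWhile (\<lambda>y. y \<noteq> k) (u @ k # v) = u" if "k \<notin> set u" for u v :: "'a list"
    using that by (induction u) auto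
  then show ?thesis using assms by (metis append_same_eq same_append_eq list.inject)
qed

text \<open>
  Weights multiply under concatenation, so only unique readability has to be secured: as \<open>k\<close> does
  not occur in the left parts, it marks the cut.
\<close>

lemma gf_join:
  assumes A: "finite A" and L: "L \<subseteq> lists A" and M: "M \<subseteq> lists A"
    and k: "\<And>u. u \<in> L \<Longrightarrow> k \<notin> set u"
  shows "gf (join k L M) = letter_gf k * (gf L * gf M)"
proof (rule fps_ext)
  fix m
  let ?L = "\<lambda>i. {u. u \<in> L \<and> length u = i}" and ?M = "\<lambda>i. {v. v \<in> M \<and> length v = i}"
  let ?wt = "\<lambda>w. monom 1 (sum_list w) :: int poly"
  show "fps_nth (gf (join k L M)) m = fps_nth (letter_gf k * (gf L * gf M)) m"
  proof (cases m)
    case 0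
    have "{w. w \<in> join k L M \<and> length w = 0} = {}" by (auto simp: join_def)
    with 0 show ?thesis by (simp only: gf_def) (simp add: letter_gf_def)
  next
    case (Suc j)
    \<comment> \<open>Words of length \<open>Suc j\<close> in the join, indexed by the length \<open>i\<close> of their left part.\<close>
    let ?S = "SIGMA i:{0..j}. ?L i \<times> ?M (j - i)"
    have "fps_nth (letter_gf k * (gf L * gf M)) m
        = monom 1 k * (\<Sum>i=0..j. (\<Sum>u\<in>?L i. ?wt u) * (\<Sum>v\<in>?M (j - i). ?wt v))"
      unfolding letter_gf_def Suc mult.assoc fps_X_mult_nth fps_mult_left_const_nth
      by (simp add: fps_mult_nth gf_def)
    also have "\<dots> = monom 1 k * (\<Sum>i=0..j. \<Sum>(u, v)\<in>?L i \<times> ?M (j - i). ?wt u * ?wt v)"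
      by (simp add: sum_product sum.cartesian_product)
    also have "\<dots> = monom 1 k * (\<Sum>(i, u, v)\<in>?S. ?wt u * ?wt v)"
      by (subst sum.Sigma) (auto intro: finite_words_of_length[OF A L] finite_words_of_length[OF A M])
    also have "\<dots> = (\<Sum>(i, u, v)\<in>?S. ?wt (u @ k # v))"
      unfolding sum_distrib_left by (rule sum.cong) (auto simp: mult_monom add_ac)
    also have "\<dots> = (\<Sum>s\<in>?S. ?wt ((\<lambda>(i, u, v). u @ k # v) s))"
      by (rule sum.cong) auto
    also have "\<dots> = (\<Sum>w | w \<in> join k L M \<and> length w = m. ?wt w)"
    proof (rule sum.reindex_bij_betw)
      have "inj_on (\<lambda>(i, u, v). u @ k # v) ?S"
      proof (rule inj_onI)
        fix s s' assume s: "s \<in> ?S" "s' \<in> ?S"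
          and eq: "(\<lambda>(i, u, v). u @ k # v) s = (\<lambda>(i, u, v). u @ k # v) s'"
        obtain i u v i' u' v' where [simp]: "s = (i, u, v)" "s' = (i', u', v')"
          by (cases s, cases s') auto
        have "u = u' \<and> v = v'"
          by (rule first_occurrence_unique) (use s eq k in auto)
        then show "s = s'" using s by simp
      qed
      moreover have "(\<lambda>(i, u, v). u @ k # v) ` ?S = {w. w \<in> join k L M \<and> length w = m}"
      proof
        show "{w. w \<in> join k L M \<and> length w = m} \<subseteq> (\<lambda>(i, u, v). u @ k # v) ` ?S"
        proof
          fix w assume "w \<in> {w. w \<in> join k L M \<and> length w = m}"
          then obtain u v where "u \<in> L" "v \<in> M" "w = u @ k # v" "length u + length v = j"
            by (auto simp: join_def Suc)
          then show "w \<in> (\<lambda>(i, u, v). u @ k # v) ` ?S"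
            by (intro image_eqI[of _ _ "(length u, u, v)"]) auto
        qed
      qed (auto simp: join_def Suc)
      ultimately show "bij_betw (\<lambda>(i, u, v). u @ k # v) ?S {w. w \<in> join k L M \<and> length w = m}"
        by (simp add: bij_betw_def)
    qed
    finally show ?thesis by (simp add: gf_def)
  qed
qed

text \<open>The factors \<open>1 - z a\<close> and \<open>1 - z b\<close> can be cancelled because their constant term is 1.\<close>

lemma one_minus_letter_gf_nonzero: "1 - letter_gf k * f \<noteq> 0"
proof
  assume "1 - letter_gf k * f = 0"
  then have "fps_nth (1 - letter_gf k * f) 0 = 0" by simp
  then show False by (simp add: letter_gf_def)
qed

lemma gf_split_first:
  assumes A: "finite A" and k: "k \<in> A"
  shows "gf {w \<in> lists A. P w}
    = gf {w \<in> lists (A - {k}). P w}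
      + gf {u @ k # v | u v. u \<in> lists (A - {k}) \<and> v \<in> lists A \<and> P (u @ k # v)}"
proof -
  have "{w \<in> lists A. P w} = {w \<in> lists (A - {k}). P w}
      \<union> {u @ k # v | u v. u \<in> lists (A - {k}) \<and> v \<in> lists A \<and> P (u @ k # v)}" (is "?W = ?W1 \<union> ?W2")
  proof
    show "?W \<subseteq> ?W1 \<union> ?W2"
    proof
      fix w assume w: "w \<in> ?W"
      show "w \<in> ?W1 \<union> ?W2"
      proof (cases "k \<in> set w")
        case True
        then obtain u v where "w = u @ k # v" "k \<notin> set u" by (auto dest: split_list_first)
        with w show ?thesis by auto
      qed (use w in auto)
    qed
  qed (use k in auto)
  moreover have "gf (?W1 \<union> ?W2) = gf ?W1 + gf ?W2"
    using k by (intro gf_Un_disjoint[OF A]) auto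
  ultimately show ?thesis by simp
qed

section \<open>Shuffles of two sets of factors\<close>

definition contains :: "('a list \<Rightarrow> bool) \<Rightarrow> 'a list \<Rightarrow> bool" where
  "contains T u \<longleftrightarrow> (\<exists>f. sublist f u \<and> T f)"

text \<open>A factor that straddled the cut would have to contain the letter \<open>k\<close>.\<close>

lemma sublist_around_letter:
  assumes "k \<notin> set f"
  shows "sublist f (u @ k # v) \<longleftrightarrow> sublist f u \<or> sublist f v"
  using assms
  by (auto simp: sublist_append sublist_Cons_right prefix_Cons dest: suffix_imp_sublist)

text \<open>
  Reading \<open>below\<close> as \<open><\<close> gives the patterns with a largest middle letter, reading it as \<open>>\<close> those with
  a smallest one.
\<close>

locale letter_order =
  fixes below :: "nat \<Rightarrow> nat \<Rightarrow> bool"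
  assumes irrefl: "\<not> below x x"
    and trans: "below x y \<Longrightarrow> below y z \<Longrightarrow> below x z"
    and total: "x \<noteq> y \<Longrightarrow> below x y \<or> below y x"
begin

definition contains_below :: "(nat list \<Rightarrow> bool) \<Rightarrow> nat \<Rightarrow> nat list \<Rightarrow> bool" where
  "contains_below T x = contains (\<lambda>f. T f \<and> (\<forall>y \<in> set f. below y x))"

text \<open>
  A word has a shuffle of \<open>T\<close> and \<open>N\<close> if some letter \<open>x\<close> has a \<open>T\<close>-factor to its left and an
  \<open>N\<close>-factor to its right, both with all letters below \<open>x\<close>. Nothing relates the two factors to each
  other: this is the incomparability of the two outer words of the pattern.
\<close>

definition has_shuffle :: "(nat list \<Rightarrow> bool) \<Rightarrow> (nat list \<Rightarrow> bool) \<Rightarrow> nat list \<Rightarrow> bool" where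
  "has_shuffle T N w \<longleftrightarrow>
     (\<exists>u x v. w = u @ x # v \<and> contains_below T x u \<and> contains_below N x v)"

lemma contains_below_iff:
  "contains_below T x u \<longleftrightarrow> (\<exists>f. sublist f u \<and> T f \<and> (\<forall>y \<in> set f. below y x))"
  unfolding contains_below_def contains_def ..

lemma contains_below_extend:
  assumes "contains_below T x v"
  shows "contains_below T x (u @ v @ w)"
proof -
  obtain f where "sublist f v" "T f" "\<forall>y \<in> set f. below y x"
    using assms unfolding contains_below_iff by blast
  moreover from this(1) have "sublist f (u @ v @ w)"
    by (rule sublist_order.order.trans) (rule sublist_appendI)
  ultimately show ?thesis unfolding contains_below_iff by blast
qed

lemma contains_below_mono:
  assumes "contains_below T x v" and "x = y \<or> below x y"
  shows "contains_below T y v"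
proof -
  obtain f where "sublist f v" "T f" "\<forall>y \<in> set f. below y x"
    using assms(1) unfolding contains_below_iff by blast
  moreover have "below z y" if "below z x" for z using that assms(2) trans by auto
  ultimately show ?thesis unfolding contains_below_iff by blast
qed

lemma contains_below_imp_contains: "contains_below T x v \<Longrightarrow> contains T v"
  unfolding contains_below_iff contains_def by blast

lemma contains_below_if_all_below:
  assumes "contains T u" and "\<And>y. y \<in> set u \<Longrightarrow> below y x"
  shows "contains_below T x u"
proof -
  obtain f where "sublist f u" "T f" using assms(1) unfolding contains_def by blast
  moreover from this(1) have "set f \<subseteq> set u" by (rule set_mono_sublist)
  ultimately show ?thesis using assms(2) unfolding contains_below_iff by blast
qed

lemma contains_below_around_letter:
  assumes "\<not> below k x"
  shows "contains_below T x (u @ k # v) \<longleftrightarrow> contains_below T x u \<or> contains_below T x v"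
proof -
  have "k \<notin> set f" if "\<forall>y \<in> set f. below y x" for f
    using that assms by auto
  then show ?thesis
    unfolding contains_below_iff using sublist_around_letter by (metis (no_types, lifting))
qed

lemma has_shuffle_imp_contains: "has_shuffle T N w \<Longrightarrow> contains T w"
  unfolding has_shuffle_def
  by (metis append_Nil contains_below_extend contains_below_imp_contains)

lemma has_shuffle_imp_contains_below_right:
  assumes "has_shuffle T N w" and "\<And>y. y \<in> set w \<Longrightarrow> y = k \<or> below y k"
  shows "contains_below N k w"
proof -
  obtain u x v where w: "w = u @ x # v" and v: "contains_below N x v"
    using assms(1) unfolding has_shuffle_def by blast
  have "contains_below N k v" using v assms(2) w by (auto intro: contains_below_mono)
  then show ?thesis using contains_below_extend[of N k v "u @ [x]" "[]"] w by simp
qed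

text \<open>
  If the middle letter \<open>x\<close> of an occurrence lies in \<open>u\<close>, its right factor lies in \<open>u\<close>, giving an
  occurrence in \<open>u\<close>, or in \<open>v\<close>, where it remains below \<open>k\<close>; then the left factor lies in \<open>u\<close> and
  \<open>k\<close> may replace \<open>x\<close>. The case of \<open>x\<close> in \<open>v\<close> is the mirror image.
\<close>

lemma has_shuffle_around_maximum:
  assumes u: "\<And>y. y \<in> set u \<Longrightarrow> below y k" and v: "\<And>y. y \<in> set v \<Longrightarrow> y = k \<or> below y k"
  shows "has_shuffle T N (u @ k # v) \<longleftrightarrow>
    has_shuffle T N u \<or> has_shuffle T N v \<or> (contains T u \<and> contains_below N k v)"
proof
  assume "has_shuffle T N (u @ k # v)"
  then obtain p x s where eq: "u @ k # v = p @ x # s"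
    and T: "contains_below T x p" and N: "contains_below N x s"
    unfolding has_shuffle_def by blast
  from eq consider (left) r where "u = p @ x # r" "s = r @ k # v"
    | (mid) "p = u" "x = k" "s = v"
    | (right) r where "p = u @ k # r" "v = r @ x # s"
    by (auto simp: append_eq_append_conv2 Cons_eq_append_conv append_eq_Cons_conv)
  then show "has_shuffle T N u \<or> has_shuffle T N v \<or> (contains T u \<and> contains_below N k v)"
  proof cases
    case left
    then have x: "below x k" using u by simp
    then have "\<not> below k x" using trans irrefl by blast
    then have "contains_below N x r \<or> contains_below N x v"
      using N left(2) contains_below_around_letter by simp
    then show ?thesis
    proof
      assume "contains_below N x r"
      then show ?thesis using left T unfolding has_shuffle_def by blast
    next
      assume "contains_below N x v"
      then have "contains_below N k v" using x contains_below_mono by blast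
      moreover have "contains T u"
        using contains_below_extend[OF T, of "[]" "x # r"] left(1) contains_below_imp_contains by simp
      ultimately show ?thesis by blast
    qed
  next
    case mid
    then show ?thesis using T N contains_below_imp_contains by blast
  next
    case right
    then have x: "x = k \<or> below x k" using v by simp
    then have "\<not> below k x" using trans irrefl by blast
    then have "contains_below T x u \<or> contains_below T x r"
      using T right(1) contains_below_around_letter by simp
    then show ?thesis
    proof
      assume "contains_below T x r"
      then show ?thesis using right N unfolding has_shuffle_def by blast
    next
      assume "contains_below T x u"
      moreover have "contains_below N k v"
        using contains_below_extend[OF contains_below_mono[OF N x], of "r @ [x]" "[]"] right(2) by simp
      ultimately show ?thesis using contains_below_imp_contains by blast
    qed
  qed
next
  assume "has_shuffle T N u \<or> has_shuffle T N v \<or> (contains T u \<and> contains_below N k v)"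
  then consider (left) "has_shuffle T N u" | (right) "has_shuffle T N v"
    | (mid) "contains T u" "contains_below N k v" by blast
  then show "has_shuffle T N (u @ k # v)"
  proof cases
    case left
    then obtain p x s where "u = p @ x # s" "contains_below T x p" "contains_below N x s"
      unfolding has_shuffle_def by blast
    then show ?thesis
      using contains_below_extend[of N x s "[]" "k # v"] unfolding has_shuffle_def by force
  next
    case right
    then obtain p x s where "v = p @ x # s" "contains_below T x p" "contains_below N x s"
      unfolding has_shuffle_def by blast
    then show ?thesis
      using contains_below_extend[of T x p "u @ [k]" "[]"] unfolding has_shuffle_def
      by (metis append.assoc append_Cons append_Nil append_Nil2)
  next
    case mid
    then show ?thesis using contains_below_if_all_below[OF mid(1) u] unfolding has_shuffle_def by blast
  qed
qed

text \<open>
  A word without an \<open>N\<close>-factor below \<open>k\<close> is a sequence of words over \<open>A - {k}\<close> without an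
  \<open>N\<close>-factor, separated by letters \<open>k\<close>; so its generating function is the geometric series
  \<open>b / (1 - z b)\<close>, obtained here from \<open>D = b + z b D\<close>.
\<close>

lemma gf_avoiding_below_maximum:
  assumes A: "finite A" and k: "k \<in> A" and max: "\<And>y. y \<in> A - {k} \<Longrightarrow> below y k"
  shows "gf {w \<in> lists A. \<not> contains_below N k w} * (1 - letter_gf k * gf {w \<in> lists (A - {k}). \<not> contains N w})
    = gf {w \<in> lists (A - {k}). \<not> contains N w}"
proof -
  let ?B = "A - {k}"
  have cont: "contains_below N k u \<longleftrightarrow> contains N u" if "u \<in> lists ?B" for u
  proof
    assume "contains N u"
    moreover have "below y k" if "y \<in> set u" for y
      using that \<open>u \<in> lists ?B\<close> by (intro max) auto
    ultimately show "contains_below N k u" by (rule contains_below_if_all_below)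
  qed (rule contains_below_imp_contains)
  have 1: "{w \<in> lists ?B. \<not> contains_below N k w} = {w \<in> lists ?B. \<not> contains N w}"
    using cont by blast
  have 2: "{u @ k # v | u v. u \<in> lists ?B \<and> v \<in> lists A \<and> \<not> contains_below N k (u @ k # v)}
      = join k {w \<in> lists ?B. \<not> contains N w} {w \<in> lists A. \<not> contains_below N k w}"
    unfolding contains_below_around_letter[OF irrefl] join_def using cont by fast
  have "gf {w \<in> lists A. \<not> contains_below N k w}
      = gf {w \<in> lists ?B. \<not> contains N w} + letter_gf k *
        (gf {w \<in> lists ?B. \<not> contains N w} * gf {w \<in> lists A. \<not> contains_below N k w})"
    by (subst gf_split_first[OF A k], subst 1, subst 2, subst gf_join[OF A]) auto
  then show ?thesis by (simp add: algebra_simps)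
qed

text \<open>
  In a word \<open>u k v\<close> avoiding the shuffle, either \<open>u\<close> has no \<open>T\<close>-factor, and \<open>v\<close> is any word that
  avoids the shuffle; or \<open>u\<close> has a \<open>T\<close>-factor but not the shuffle, counted by \<open>c - a\<close>, and \<open>v\<close> has
  no \<open>N\<close>-factor below \<open>k\<close>, and then \<open>v\<close> avoids the shuffle by itself.
\<close>

lemma gf_avoiding_shuffle:
  fixes T N :: "nat list \<Rightarrow> bool"
  assumes A: "finite A" and k: "k \<in> A" and max: "\<And>y. y \<in> A - {k} \<Longrightarrow> below y k"
  defines "a \<equiv> gf {w \<in> lists (A - {k}). \<not> contains T w}"
    and "b \<equiv> gf {w \<in> lists (A - {k}). \<not> contains N w}"
    and "c \<equiv> gf {w \<in> lists (A - {k}). \<not> has_shuffle T N w}"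
    and "z \<equiv> letter_gf k"
  shows "gf {w \<in> lists A. \<not> has_shuffle T N w} * ((1 - z * a) * (1 - z * b)) = c - z * (a * b)"
proof -
  let ?B = "A - {k}"
  let ?F = "{w \<in> lists A. \<not> has_shuffle T N w}"
  let ?D = "{w \<in> lists A. \<not> contains_below N k w}"
  let ?a = "{w \<in> lists ?B. \<not> contains T w}"
  let ?e = "{w \<in> lists ?B. contains T w \<and> \<not> has_shuffle T N w}"
  have c: "c = a + gf ?e"
  proof -
    have "{w \<in> lists ?B. \<not> has_shuffle T N w} = ?a \<union> ?e"
      by (auto dest: has_shuffle_imp_contains)
    moreover have "gf (?a \<union> ?e) = gf ?a + gf ?e"
      by (rule gf_Un_disjoint[OF A]) auto
    ultimately show ?thesis unfolding c_def a_def by (simp only:)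
  qed
  have avoid: "\<not> has_shuffle T N (u @ k # v) \<longleftrightarrow>
      (\<not> contains T u \<and> \<not> has_shuffle T N v)
      \<or> (contains T u \<and> \<not> has_shuffle T N u \<and> \<not> contains_below N k v)"
    if "u \<in> lists ?B" "v \<in> lists A" for u v
  proof -
    have v: "y = k \<or> below y k" if "y \<in> set v" for y
      using that \<open>v \<in> lists A\<close> max by auto
    have "has_shuffle T N (u @ k # v) \<longleftrightarrow>
        has_shuffle T N u \<or> has_shuffle T N v \<or> (contains T u \<and> contains_below N k v)"
      using that(1) max v by (intro has_shuffle_around_maximum) auto
    moreover have "has_shuffle T N v \<Longrightarrow> contains_below N k v"
      using has_shuffle_imp_contains_below_right v by blast
    ultimately show ?thesis
      using has_shuffle_imp_contains by blast
  qed
  have split: "{u @ k # v | u v. u \<in> lists ?B \<and> v \<in> lists A \<and> \<not> has_shuffle T N (u @ k # v)}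
      = join k ?a ?F \<union> join k ?e ?D"
  proof -
    have "u \<in> lists ?B \<and> v \<in> lists A \<and> \<not> has_shuffle T N (u @ k # v)
        \<longleftrightarrow> (u, v) \<in> ?a \<times> ?F \<union> ?e \<times> ?D" for u v
      using avoid[of u v] by auto
    then show ?thesis unfolding join_def image_Un[symmetric] by auto
  qed
  have "join k ?a ?F \<inter> join k ?e ?D = {}"
    unfolding join_def by (auto dest: first_occurrence_unique)
  moreover have "join k ?a ?F \<subseteq> lists A" "join k ?e ?D \<subseteq> lists A"
    using k by (auto simp: join_def)
  ultimately have "gf (join k ?a ?F \<union> join k ?e ?D) = gf (join k ?a ?F) + gf (join k ?e ?D)"
    by (intro gf_Un_disjoint[OF A])
  also have "\<dots> = z * (a * gf ?F) + z * (gf ?e * gf ?D)"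
    unfolding z_def a_def by (intro arg_cong2[where f = "(+)"] gf_join[OF A]) auto
  finally have F: "gf ?F = c + z * (a * gf ?F) + z * (gf ?e * gf ?D)"
    using gf_split_first[OF A k, of "\<lambda>w. \<not> has_shuffle T N w"] split by (simp add: c_def)
  \<comment> \<open>Eliminate \<open>D\<close>: multiplying by \<open>1 - z b\<close> turns it into \<open>b\<close>.\<close>
  have D: "gf ?D * (1 - z * b) = b"
    unfolding z_def b_def by (rule gf_avoiding_below_maximum[OF A k max])
  have F_eq: "gf ?F * (1 - z * a) = c + z * (c - a) * gf ?D"
    using F c by (simp add: algebra_simps)
  have "gf ?F * ((1 - z * a) * (1 - z * b)) = (c + z * (c - a) * gf ?D) * (1 - z * b)"
    unfolding F_eq[symmetric] by (rule mult.assoc[symmetric])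
  also have "\<dots> = c * (1 - z * b) + z * (c - a) * (gf ?D * (1 - z * b))"
    by (simp only: distrib_right mult.assoc)
  also have "\<dots> = c - z * (a * b)"
    unfolding D by (simp add: algebra_simps)
  finally show ?thesis .
qed

lemma maximum_exists:
  assumes "finite A" and "A \<noteq> {}"
  obtains k where "k \<in> A" "\<And>y. y \<in> A - {k} \<Longrightarrow> below y k"
proof -
  have "\<exists>k \<in> A. \<forall>y \<in> A - {k}. below y k"
    using assms
  proof (induction A rule: finite_ne_induct)
    case (insert x F)
    then obtain k where k: "k \<in> F" "\<forall>y \<in> F - {k}. below y k" by blast
    then show ?case using total[of x k] trans insert.hyps by blast
  qed simp
  then show ?thesis using that by blast
qed

text \<open>
  In the functional equation for \<open>F\<close>, the order of \<open>T\<close> and \<open>N\<close> enters only through \<open>c\<close>, which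
  belongs to a smaller alphabet.
\<close>

lemma gf_avoiding_shuffle_sym:
  assumes "finite A"
  shows "gf {w \<in> lists A. \<not> has_shuffle T N w} = gf {w \<in> lists A. \<not> has_shuffle N T w}"
  using assms
proof (induction A rule: finite_psubset_induct)
  case (psubset A)
  show ?case
  proof (cases "A = {}")
    case True
    have "\<not> has_shuffle T N []" for T N by (simp add: has_shuffle_def)
    then show ?thesis using True by (auto intro!: arg_cong[of _ _ gf])
  next
    case False
    obtain k where k: "k \<in> A" and max: "\<And>y. y \<in> A - {k} \<Longrightarrow> below y k"
      using maximum_exists[OF \<open>finite A\<close> False] by blast
    define z where "z = letter_gf k"
    define a where "a = gf {w \<in> lists (A - {k}). \<not> contains T w}"
    define b where "b = gf {w \<in> lists (A - {k}). \<not> contains N w}"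
    have "gf {w \<in> lists A. \<not> has_shuffle T N w} * ((1 - z * a) * (1 - z * b))
        = gf {w \<in> lists (A - {k}). \<not> has_shuffle T N w} - z * (a * b)"
      unfolding z_def a_def b_def by (rule gf_avoiding_shuffle[OF \<open>finite A\<close> k max])
    also have "\<dots> = gf {w \<in> lists (A - {k}). \<not> has_shuffle N T w} - z * (b * a)"
      using psubset.IH[of "A - {k}"] k by (auto simp: mult.commute)
    also have "\<dots> = gf {w \<in> lists A. \<not> has_shuffle N T w} * ((1 - z * b) * (1 - z * a))"
      unfolding z_def a_def b_def by (rule gf_avoiding_shuffle[OF \<open>finite A\<close> k max, symmetric])
    finally show ?thesis
      using one_minus_letter_gf_nonzero[of k a] one_minus_letter_gf_nonzero[of k b]
      by (simp add: z_def mult.commute)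
  qed
qed

end

section \<open>Occurrences of shuffle patterns\<close>

text \<open>
  Letters are paired with the values they receive because \<open>zip\<close> turns concatenation of words into a
  union, along which the conditions of a shuffle pattern fall apart into those of its three blocks.
\<close>

definition matches :: "('a \<Rightarrow> 'a \<Rightarrow> bool) \<Rightarrow> 'a list \<Rightarrow> nat list \<Rightarrow> bool" where
  "matches lt \<rho> f \<longleftrightarrow> length f = length \<rho> \<and>
     (\<forall>(a, x) \<in> set (zip \<rho> f). \<forall>(b, y) \<in> set (zip \<rho> f). (a = b \<longrightarrow> x = y) \<and> (lt a b \<longrightarrow> x < y))"

lemma occurrence_iff_matches:
  "occurrence P \<sigma> is \<longleftrightarrow>
     sorted_wrt (<) is \<and> (\<forall>i \<in> set is. i < length \<sigma>) \<and>
     (\<forall>p. Suc p < length (letters P) \<and> Suc p \<notin> dashes P \<longrightarrow> is ! Suc p = Suc (is ! p)) \<and>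
     matches (less P) (letters P) (map ((!) \<sigma>) is)"
proof -
  have "matches (less P) \<rho> (map ((!) \<sigma>) is) \<longleftrightarrow> length is = length \<rho> \<and>
      (\<forall>p < length \<rho>. \<forall>q < length \<rho>. \<rho> ! p = \<rho> ! q \<longrightarrow> \<sigma> ! (is ! p) = \<sigma> ! (is ! q)) \<and>
      (\<forall>p < length \<rho>. \<forall>q < length \<rho>. less P (\<rho> ! p) (\<rho> ! q) \<longrightarrow> \<sigma> ! (is ! p) < \<sigma> ! (is ! q))" for \<rho>
  proof (cases "length is = length \<rho>")
    case True
    then have zip: "set (zip \<rho> (map ((!) \<sigma>) is)) = (\<lambda>p. (\<rho> ! p, \<sigma> ! (is ! p))) ` {..<length \<rho>}"
      by (auto simp: set_zip)
    show ?thesis unfolding matches_def zip ball_simps split using True by (simp add: Ball_def) blast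
  qed (simp add: matches_def)
  then show ?thesis unfolding occurrence_def Let_def by blast
qed

text \<open>
  Letters of different outer words are distinct and incomparable, so pairs of them impose nothing; an
  outer letter and the middle letter impose only \<open>below\<close>. The hypotheses on \<open>lt\<close> are what
  \<open>less_max\<close> and \<open>less_min\<close> have in common.
\<close>

lemma matches_shuffle:
  assumes "\<not> lt Mid Mid"
    and "\<And>a b. lt (Lft a) (Lft b) \<longleftrightarrow> a < b" and "\<And>a b. lt (Rgt a) (Rgt b) \<longleftrightarrow> a < b"
    and "\<And>a b. \<not> lt (Lft a) (Rgt b)" and "\<And>a b. \<not> lt (Rgt a) (Lft b)"
    and "\<And>a x y. (lt (Lft a) Mid \<longrightarrow> y < x) \<and> (lt Mid (Lft a) \<longrightarrow> x < y) \<longleftrightarrow> below y x"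
    and "\<And>a x y. (lt (Rgt a) Mid \<longrightarrow> y < x) \<and> (lt Mid (Rgt a) \<longrightarrow> x < y) \<longleftrightarrow> below y x"
    and f: "length f = length \<tau>" and g: "length g = length \<nu>"
  shows "matches lt (map Lft \<tau> @ [Mid] @ map Rgt \<nu>) (f @ [x] @ g) \<longleftrightarrow>
    (matches (<) \<tau> f \<and> (\<forall>y \<in> set f. below y x)) \<and> matches (<) \<nu> g \<and> (\<forall>y \<in> set g. below y x)"
proof -
  have F: "set f = snd ` set (zip \<tau> f)" and G: "set g = snd ` set (zip \<nu> g)"
    using f g by (metis map_snd_zip set_map)+
  have Z: "set (zip (map Lft \<tau> @ [Mid] @ map Rgt \<nu>) (f @ [x] @ g))
      = (\<lambda>(a, y). (Lft a, y)) ` set (zip \<tau> f) \<union> {(Mid, x)} \<union> (\<lambda>(a, y). (Rgt a, y)) ` set (zip \<nu> g)"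
    using f g by (auto simp: zip_map1)
  let ?C = "\<lambda>(a, y) (b, z). (a = b \<longrightarrow> y = z) \<and> (lt a b \<longrightarrow> y < (z :: nat))"
  let ?F = "(\<lambda>(a, y). (Lft a, y)) ` set (zip \<tau> f)" and ?G = "(\<lambda>(a, y). (Rgt a, y)) ` set (zip \<nu> g)"
  have split: "(\<forall>p \<in> X \<union> {m} \<union> Y. \<forall>q \<in> X \<union> {m} \<union> Y. C p q) \<longleftrightarrow>
      ((\<forall>p \<in> X. \<forall>q \<in> X. C p q) \<and> (\<forall>p \<in> X. C p m \<and> C m p)) \<and>
      (\<forall>p \<in> Y. \<forall>q \<in> Y. C p q) \<and> (\<forall>p \<in> Y. C p m \<and> C m p)"
    if "C m m" and "\<And>p q. p \<in> X \<Longrightarrow> q \<in> Y \<Longrightarrow> C p q \<and> C q p"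
    for X Y :: "(shuffle_letter \<times> nat) set" and m C
    using that by blast
  have "matches lt (map Lft \<tau> @ [Mid] @ map Rgt \<nu>) (f @ [x] @ g) \<longleftrightarrow>
      (\<forall>p \<in> ?F \<union> {(Mid, x)} \<union> ?G. \<forall>q \<in> ?F \<union> {(Mid, x)} \<union> ?G. ?C p q)"
    unfolding matches_def Z using f g by (simp add: split_beta)
  also have "\<dots> \<longleftrightarrow>
      ((\<forall>p \<in> ?F. \<forall>q \<in> ?F. ?C p q) \<and> (\<forall>p \<in> ?F. ?C p (Mid, x) \<and> ?C (Mid, x) p)) \<and>
      (\<forall>p \<in> ?G. \<forall>q \<in> ?G. ?C p q) \<and> (\<forall>p \<in> ?G. ?C p (Mid, x) \<and> ?C (Mid, x) p)"
    by (rule split) (use assms(1,4,5) in auto)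
  also have "(\<forall>p \<in> ?F. \<forall>q \<in> ?F. ?C p q) \<longleftrightarrow> matches (<) \<tau> f"
    unfolding matches_def using f assms(2) by (simp add: split_beta)
  also have "(\<forall>p \<in> ?G. \<forall>q \<in> ?G. ?C p q) \<longleftrightarrow> matches (<) \<nu> g"
    unfolding matches_def using g assms(3) by (simp add: split_beta)
  also have "(\<forall>p \<in> ?F. ?C p (Mid, x) \<and> ?C (Mid, x) p) \<longleftrightarrow> (\<forall>y \<in> set f. below y x)"
    unfolding F using assms(6)[of _ _ x] by (simp add: split_beta)
  also have "(\<forall>p \<in> ?G. ?C p (Mid, x) \<and> ?C (Mid, x) p) \<longleftrightarrow> (\<forall>y \<in> set g. below y x)"
    unfolding G using assms(7)[of _ _ x] by (simp add: split_beta)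
  finally show ?thesis .
qed

lemma consecutive_run:
  assumes "\<And>p. Suc p < length is \<Longrightarrow> is ! Suc p = Suc (is ! p)" and "is \<noteq> []"
  shows "is = [is ! 0..<is ! 0 + length is]"
proof (rule nth_equalityI)
  have "p < length is \<Longrightarrow> is ! p = is ! 0 + p" for p
    using assms(1) by (induction p) auto
  then show "p < length is \<Longrightarrow> is ! p = [is ! 0..<is ! 0 + length is] ! p" for p
    by simp
qed simp

text \<open>
  The dashes of a shuffle pattern split the positions of an occurrence into an interval, a single
  position and an interval. The outer intervals may be empty; their starting points are then
  arbitrary within the stated bounds, and the proof picks \<open>m\<close> and \<open>Suc m\<close>.
\<close>

lemma positions_iff:
  assumes "r = s + 1 + t"
  shows "length is = r \<and> sorted_wrt (<) is \<and> (\<forall>i \<in> set is. i < n) \<and>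
      (\<forall>p. Suc p < r \<and> Suc p \<notin> {s, Suc s} \<longrightarrow> is ! Suc p = Suc (is ! p)) \<longleftrightarrow>
    (\<exists>i m j. is = [i..<i + s] @ [m] @ [j..<j + t] \<and> i + s \<le> m \<and> m < j \<and> j + t \<le> n)"
    (is "?L \<longleftrightarrow> ?R")
proof
  assume L: ?L
  define ls where "ls = take s is"
  define m where "m = is ! s"
  define rs where "rs = drop (Suc s) is"
  have "length is = s + 1 + t" using L assms by simp
  then have "is": "is = ls @ [m] @ rs" and ls: "length ls = s" and rs: "length rs = t"
    by (auto simp: ls_def m_def rs_def intro: id_take_nth_drop)
  have step: "is ! Suc p = Suc (is ! p)" if "Suc p < s + 1 + t" "Suc p \<noteq> s" "p \<noteq> s" for p
    using L that assms by auto
  have sorted: "sorted_wrt (<) (ls @ [m] @ rs)" and bound: "\<forall>i \<in> set (ls @ [m] @ rs). i < n"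
    using L "is" by auto
  obtain i where i: "ls = [i..<i + s]" "i + s \<le> m"
  proof (cases "ls = []")
    case False
    have "ls ! Suc p = Suc (ls ! p)" if "Suc p < length ls" for p
      using step[of p] that by (simp add: "is" ls nth_append)
    from consecutive_run[OF this False] have run: "ls = [ls ! 0..<ls ! 0 + s]"
      using ls by simp
    have "s > 0" using False ls by auto
    moreover have "set ls = {ls ! 0..<ls ! 0 + s}"
      using arg_cong[OF run, of set] by (simp only: set_upt)
    ultimately have "ls ! 0 + s - 1 \<in> set ls" by simp
    then have "ls ! 0 + s - 1 < m" using sorted by (auto simp: sorted_wrt_append)
    then show ?thesis using that[OF run] by simp
  qed (use that[of m] ls in auto)
  obtain j where j: "rs = [j..<j + t]" "m < j" "j + t \<le> n"
  proof (cases "rs = []")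
    case False
    have "rs ! Suc p = Suc (rs ! p)" if "Suc p < length rs" for p
      using step[of "s + 1 + p"] that by (simp add: "is" ls rs nth_append)
    from consecutive_run[OF this False] have run: "rs = [rs ! 0..<rs ! 0 + t]"
      using rs by simp
    have "t > 0" using False rs by auto
    moreover have "set rs = {rs ! 0..<rs ! 0 + t}"
      using arg_cong[OF run, of set] by (simp only: set_upt)
    ultimately have "rs ! 0 + t - 1 \<in> set rs" "rs ! 0 \<in> set rs" by simp_all
    then have "rs ! 0 + t - 1 < n" "m < rs ! 0" using sorted bound by (auto simp: sorted_wrt_append)
    then show ?thesis using that[OF run] by simp
  next
    case True
    then show ?thesis using that[of "Suc m"] rs bound by auto
  qed
  show ?R using "is" i j by blast
next
  assume ?R
  then obtain i m j where "is": "is = [i..<i + s] @ [m] @ [j..<j + t]"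
    and "i + s \<le> m" "m < j" "j + t \<le> n" by blast
  then show ?L
    using assms by (auto simp: sorted_wrt_append nth_append nth_Cons split: nat.splits)
qed

lemma map_nth_upt: "i + l \<le> length xs \<Longrightarrow> map ((!) xs) [i..<i + l] = take l (drop i xs)"
  by (rule nth_equalityI) auto

context letter_order
begin

text \<open>
  Occurrences are described by positions and \<open>has_shuffle\<close> by cutting the word into pieces; when
  matching factors have a fixed length, the two descriptions can be translated into each other.
\<close>

lemma has_shuffle_iff_positions:
  assumes T: "\<And>f. T f \<Longrightarrow> length f = s" and N: "\<And>g. N g \<Longrightarrow> length g = t"
  shows "has_shuffle T N \<sigma> \<longleftrightarrow>
    (\<exists>i m j. i + s \<le> m \<and> m < j \<and> j + t \<le> length \<sigma> \<and>
      (T (map ((!) \<sigma>) [i..<i + s]) \<and> (\<forall>y \<in> set (map ((!) \<sigma>) [i..<i + s]). below y (\<sigma> ! m))) \<and>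
      N (map ((!) \<sigma>) [j..<j + t]) \<and> (\<forall>y \<in> set (map ((!) \<sigma>) [j..<j + t]). below y (\<sigma> ! m)))"
    (is "_ \<longleftrightarrow> (\<exists>i m j. ?P i m j)")
proof
  assume "has_shuffle T N \<sigma>"
  then obtain p f q x p' g q' where \<sigma>: "\<sigma> = (p @ f @ q) @ x # (p' @ g @ q')"
    and f: "T f" "\<forall>y \<in> set f. below y x" and g: "N g" "\<forall>y \<in> set g. below y x"
    unfolding has_shuffle_def contains_below_def contains_def sublist_def by blast
  let ?m = "length (p @ f @ q)" and ?i = "length p"
  let ?j = "Suc (length (p @ f @ q) + length p')"
  have s: "length f = s" and t: "length g = t" using T N f g by auto
  have x: "\<sigma> ! ?m = x" unfolding \<sigma> by (rule nth_append_length)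
  have "map ((!) \<sigma>) [?i..<?i + s] = f"
    by (subst map_nth_upt) (auto simp: \<sigma> s)
  moreover have "map ((!) \<sigma>) [?j..<?j + t] = g"
    by (subst map_nth_upt) (auto simp: \<sigma> t)
  moreover have "?i + s \<le> ?m" "?m < ?j" "?j + t \<le> length \<sigma>"
    by (auto simp: \<sigma> s t)
  ultimately have "?P ?i ?m ?j" using f g x by metis
  then show "\<exists>i m j. ?P i m j" by blast
next
  assume "\<exists>i m j. ?P i m j"
  then obtain i m j where P: "?P i m j" by blast
  let ?f = "map ((!) \<sigma>) [i..<i + s]" and ?g = "map ((!) \<sigma>) [j..<j + t]"
  have \<sigma>: "\<sigma> = take m \<sigma> @ \<sigma> ! m # drop (Suc m) \<sigma>"
    using P by (intro id_take_nth_drop) auto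
  have "?f = take s (drop i (take m \<sigma>))"
    using P by (subst map_nth_upt) (auto simp: drop_take)
  then have "sublist ?f (take m \<sigma>)"
    by (metis sublist_drop sublist_take sublist_order.order.trans)
  moreover have "?g = take t (drop (j - Suc m) (drop (Suc m) \<sigma>))"
    using P by (subst map_nth_upt) auto
  then have "sublist ?g (drop (Suc m) \<sigma>)"
    by (metis sublist_drop sublist_take sublist_order.order.trans)
  ultimately show "has_shuffle T N \<sigma>"
    unfolding has_shuffle_def contains_below_def contains_def using \<sigma> P by blast
qed

lemma avoids_shuffle_iff:
  assumes lt: "\<not> lt Mid Mid"
    "\<And>a b. lt (Lft a) (Lft b) \<longleftrightarrow> a < b" "\<And>a b. lt (Rgt a) (Rgt b) \<longleftrightarrow> a < b"
    "\<And>a b. \<not> lt (Lft a) (Rgt b)" "\<And>a b. \<not> lt (Rgt a) (Lft b)"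
    "\<And>a x y. (lt (Lft a) Mid \<longrightarrow> y < x) \<and> (lt Mid (Lft a) \<longrightarrow> x < y) \<longleftrightarrow> below y x"
    "\<And>a x y. (lt (Rgt a) Mid \<longrightarrow> y < x) \<and> (lt Mid (Rgt a) \<longrightarrow> x < y) \<longleftrightarrow> below y x"
  shows "avoids \<sigma> (shuffle lt \<tau> \<nu>) \<longleftrightarrow> \<not> has_shuffle (matches (<) \<tau>) (matches (<) \<nu>) \<sigma>"
proof -
  let ?s = "length \<tau>" and ?t = "length \<nu>" and ?\<rho> = "map Lft \<tau> @ [Mid] @ map Rgt \<nu>"
  have "occurrence (shuffle lt \<tau> \<nu>) \<sigma> is \<longleftrightarrow>
      (\<exists>i m j. is = [i..<i + ?s] @ [m] @ [j..<j + ?t] \<and> i + ?s \<le> m \<and> m < j \<and> j + ?t \<le> length \<sigma>)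
      \<and> matches lt ?\<rho> (map ((!) \<sigma>) is)" (is "_ \<longleftrightarrow> _ \<and> ?M is") for "is"
  proof -
    have "?M is \<Longrightarrow> length is = length ?\<rho>" unfolding matches_def by simp
    then show ?thesis
      unfolding occurrence_iff_matches shuffle_def pop.sel
      by (subst positions_iff[where r = "length ?\<rho>", symmetric]) auto
  qed
  moreover have "?M ([i..<i + ?s] @ [m] @ [j..<j + ?t]) \<longleftrightarrow>
      (matches (<) \<tau> (map ((!) \<sigma>) [i..<i + ?s]) \<and> (\<forall>y \<in> set (map ((!) \<sigma>) [i..<i + ?s]). below y (\<sigma> ! m))) \<and>
      matches (<) \<nu> (map ((!) \<sigma>) [j..<j + ?t]) \<and> (\<forall>y \<in> set (map ((!) \<sigma>) [j..<j + ?t]). below y (\<sigma> ! m))"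
    for i m j
    using matches_shuffle[of lt below, OF lt, of "map ((!) \<sigma>) [i..<i + ?s]" \<tau> "map ((!) \<sigma>) [j..<j + ?t]" \<nu> "\<sigma> ! m"]
    by simp
  moreover have "has_shuffle (matches (<) \<tau>) (matches (<) \<nu>) \<sigma> \<longleftrightarrow>
    (\<exists>i m j. i + ?s \<le> m \<and> m < j \<and> j + ?t \<le> length \<sigma> \<and>
      (matches (<) \<tau> (map ((!) \<sigma>) [i..<i + ?s]) \<and> (\<forall>y \<in> set (map ((!) \<sigma>) [i..<i + ?s]). below y (\<sigma> ! m))) \<and>
      matches (<) \<nu> (map ((!) \<sigma>) [j..<j + ?t]) \<and> (\<forall>y \<in> set (map ((!) \<sigma>) [j..<j + ?t]). below y (\<sigma> ! m)))"
    by (rule has_shuffle_iff_positions) (auto simp: matches_def)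
  ultimately show ?thesis unfolding avoids_def by metis
qed

text \<open>
  The coefficient of \<open>x\<^sup>n y\<^sup>m\<close> counts the avoiding compositions of \<open>n\<close> with \<open>m\<close> parts, so symmetry
  of the generating function is equivalence of the patterns.
\<close>

lemma pop_equiv_if_avoids_iff:
  assumes P: "\<And>\<sigma>. avoids \<sigma> P \<longleftrightarrow> \<not> has_shuffle T N \<sigma>"
    and Q: "\<And>\<sigma>. avoids \<sigma> Q \<longleftrightarrow> \<not> has_shuffle N T \<sigma>"
  shows "pop_equiv P Q"
proof -
  have count: "int (card {\<sigma> \<in> compositions A n m. \<not> has_shuffle T N \<sigma>})
      = coeff (fps_nth (gf {w \<in> lists A. \<not> has_shuffle T N w}) m) n" if "finite A" for A n m T N
    by (subst card_eq_coeff_gf[OF that, symmetric])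
      (auto simp: compositions_def lists_eq_set intro!: arg_cong[of _ _ card])
  have "int (card {\<sigma> \<in> compositions A n m. avoids \<sigma> P}) = int (card {\<sigma> \<in> compositions A n m. avoids \<sigma> Q})"
    if "finite A" for A n m
    unfolding P Q count[OF that] using gf_avoiding_shuffle_sym[OF that, of T N] by simp
  then show ?thesis unfolding pop_equiv_def by simp
qed

end

interpretation up: letter_order "(<)"
  by unfold_locales auto

interpretation down: letter_order "(>)"
  by unfold_locales auto

theorem corollary3p6:
  fixes \<tau> \<nu> :: "nat list"
  assumes "consecutive_pattern \<tau>" and "consecutive_pattern \<nu>"
  shows "pop_equiv (shuffle_max \<tau> \<nu>) (shuffle_max \<nu> \<tau>) \<and>
         pop_equiv (shuffle_min \<tau> \<nu>) (shuffle_min \<nu> \<tau>)"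
proof
  show "pop_equiv (shuffle_max \<tau> \<nu>) (shuffle_max \<nu> \<tau>)"
    unfolding shuffle_max_def
    by (rule up.pop_equiv_if_avoids_iff; rule up.avoids_shuffle_iff) auto
  show "pop_equiv (shuffle_min \<tau> \<nu>) (shuffle_min \<nu> \<tau>)"
    unfolding shuffle_min_def
    by (rule down.pop_equiv_if_avoids_iff; rule down.avoids_shuffle_iff) auto
qed

end
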